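(* Let $X$ be a nonempty set, $d$ a metric on $X$, $\mathcal R\subseteq X\times X$ a reflexive relation on $X$, and $T:X\to X$ a map. Put $\mathcal S=\mathcal R\cup\mathcal R^{-1}$. Suppose that (i) $T$ is $(d,\mathcal R;\varphi)$-contractive for some $\varphi\in\mathcal F_0(in,re;Bro)(\mathbb R_+)$; (ii) $X$ is $(d,\mathcal R)$-complete and $\mathcal R$ is $d$-almost-selfclosed; (iii) $T$ is $\mathcal R$-increasing and $\mathcal R$-semi-progressive. Then $T$ is $\mathcal S^\omega$-global strongly Picard (modulo $(d,\mathcal R)$).
   Context: $\mathbb R_+=[0,\infty)$, $\mathbb R_+^0=(0,\infty)$, $\mathrm{Fix}(T)=\{x\in X: Tx=x\}$. $\mathcal F_0(in,re;Bro)(\mathbb R_+)$ is the class of functions $\varphi:\mathbb R_+\to\mathbb R_+$ with $\varphi(0)=0$ that are increasing ($s\le t$ implies $\varphi(s)\le\varphi(t)$), regressive ($\varphi(t)<t$ for all $t>0$), and Browder admissible: every sequence $(t_n)_{n\ge0}$ in $\mathbb R_+^0$ with $t_{n+1}\le\varphi(t_n)$ for all $n$ satisfies $\sum_n t_n<\infty$. $T$ is $(d,\mathcal R;\varphi)$-contractive if $d(Tx,Ty)\le\varphi(d(x,y))$ for all $x,y\in X$ with $x\mathcal R y$. A sequence $(z_n)$ in $X$ is $\mathcal R$-ascending if $z_i\mathcal R z_{i+1}$ for every $i$. $X$ is $(d,\mathcal R)$-complete if every $\mathcal R$-ascending $d$-Cauchy sequence in $X$ is $d$-convergent in $X$. $\mathcal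 R$ is $d$-almost-selfclosed if, whenever $(z_n)$ is $\mathcal R$-ascending and $d$-converges to $z\in X$, there is a subsequence $(w_n)$ of $(z_n)$ with $w_n\mathcal R z$ for all $n$. $T$ is $\mathcal R$-increasing if $x\mathcal R y$ implies $Tx\mathcal R Ty$. Put $X(T,\mathcal R)=\{x\in X: x\mathcal R Tx\}$; $T$ is $\mathcal R$-semi-progressive if $X(T,\mathcal R)\neq\emptyset$. $\mathcal S^\omega$ is the reflexive transitive cover of $\mathcal S$: $x\mathcal S^\omega y$ iff there are $k\ge2$ and $z_1,\dots,z_k\in X$ with $z_1=x$, $z_k=y$ and $z_i\mathcal S z_{i+1}$ for $1\le i\le k-1$. $T$ is $\mathcal S^\omega$-global strongly Picard (modulo $(d,\mathcal R)$) if: (a) for each $x\in X(T,\mathcal R)$, the sequence $(T^nx)_{n\ge0}$ is $d$-convergent and its limit belongs to $\mathrm{Fix}(T)$; and (b) for all $z_1,z_2\in\mathrm{Fix}(T)$, $z_1\mathcal S^\omega z_2$ implies $z_1=z_2$. *)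

theory Defs
  imports "HOL-Analysis.Analysis"
begin

text \<open>
  Functions from the half-line of nonnegative reals to itself are total functions on
  \<open>real\<close>; their values at negative arguments are never constrained or used.
\<close>

definition increasing_Rplus :: "(real \<Rightarrow> real) \<Rightarrow> bool" where
  "increasing_Rplus \<phi> \<longleftrightarrow> mono_on {0..} \<phi>"

definition regressive :: "(real \<Rightarrow> real) \<Rightarrow> bool" where
  "regressive \<phi> \<longleftrightarrow> (\<forall>t>0. \<phi> t < t)"

definition Browder_admissible :: "(real \<Rightarrow> real) \<Rightarrow> bool" where
  "Browder_admissible \<phi> \<longleftrightarrow>
     (\<forall>t :: nat \<Rightarrow> real. (\<forall>n. 0 < t n) \<and> (\<forall>n. t (Suc n) \<le> \<phi> (t n)) \<longrightarrow> summable t)"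

definition F0_in_re_Bro :: "(real \<Rightarrow> real) set" where
  "F0_in_re_Bro =
     {\<phi>. \<phi> \<in> {0..} \<rightarrow> {0..} \<and> \<phi> 0 = 0 \<and>
         increasing_Rplus \<phi> \<and> regressive \<phi> \<and> Browder_admissible \<phi>}"

definition contractive_wrt ::
  "'a set \<Rightarrow> ('a \<Rightarrow> 'a \<Rightarrow> real) \<Rightarrow> 'a rel \<Rightarrow> (real \<Rightarrow> real) \<Rightarrow> ('a \<Rightarrow> 'a) \<Rightarrow> bool" where
  "contractive_wrt X d R \<phi> T \<longleftrightarrow>
     (\<forall>x\<in>X. \<forall>y\<in>X. (x, y) \<in> R \<longrightarrow> d (T x) (T y) \<le> \<phi> (d x y))"

definition ascending :: "'a set \<Rightarrow> 'a rel \<Rightarrow> (nat \<Rightarrow> 'a) \<Rightarrow> bool" where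
  "ascending X R z \<longleftrightarrow> range z \<subseteq> X \<and> (\<forall>i. (z i, z (Suc i)) \<in> R)"

abbreviation converges_to ::
  "'a set \<Rightarrow> ('a \<Rightarrow> 'a \<Rightarrow> real) \<Rightarrow> (nat \<Rightarrow> 'a) \<Rightarrow> 'a \<Rightarrow> bool" where
  "converges_to X d z l \<equiv> limitin (Metric_space.mtopology X d) z l sequentially"

definition complete_wrt :: "'a set \<Rightarrow> ('a \<Rightarrow> 'a \<Rightarrow> real) \<Rightarrow> 'a rel \<Rightarrow> bool" where
  "complete_wrt X d R \<longleftrightarrow>
     (\<forall>z. ascending X R z \<and> Metric_space.MCauchy X d z \<longrightarrow> (\<exists>l\<in>X. converges_to X d z l))"

definition almost_selfclosed :: "'a set \<Rightarrow> ('a \<Rightarrow> 'a \<Rightarrow> real) \<Rightarrow> 'a rel \<Rightarrow> bool" where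
  "almost_selfclosed X d R \<longleftrightarrow>
     (\<forall>z. \<forall>l\<in>X. ascending X R z \<and> converges_to X d z l \<longrightarrow>
        (\<exists>r :: nat \<Rightarrow> nat. strict_mono r \<and> (\<forall>n. (z (r n), l) \<in> R)))"

definition rel_increasing :: "'a set \<Rightarrow> 'a rel \<Rightarrow> ('a \<Rightarrow> 'a) \<Rightarrow> bool" where
  "rel_increasing X R T \<longleftrightarrow>
     (\<forall>x\<in>X. \<forall>y\<in>X. (x, y) \<in> R \<longrightarrow> (T x, T y) \<in> R)"

definition progress_set :: "'a set \<Rightarrow> ('a \<Rightarrow> 'a) \<Rightarrow> 'a rel \<Rightarrow> 'a set" where
  "progress_set X T R = {x \<in> X. (x, T x) \<in> R}"

definition semi_progressive :: "'a set \<Rightarrow> 'a rel \<Rightarrow> ('a \<Rightarrow> 'a) \<Rightarrow> bool" where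
  "semi_progressive X R T \<longleftrightarrow> progress_set X T R \<noteq> {}"

definition Fix :: "'a set \<Rightarrow> ('a \<Rightarrow> 'a) \<Rightarrow> 'a set" where
  "Fix X T = {x \<in> X. T x = x}"

text \<open>
  The chain \<open>z\<close> has length \<open>k \<ge> 2\<close>, hence at least one link: for a relation that is not
  reflexive on \<open>X\<close> this is only the transitive closure.
\<close>

definition rt_cover :: "'a set \<Rightarrow> 'a rel \<Rightarrow> 'a rel" where
  "rt_cover X S =
     {(x, y). \<exists>(k::nat)\<ge>2. \<exists>z :: nat \<Rightarrow> 'a.
        (\<forall>i\<in>{1..k}. z i \<in> X) \<and> z 1 = x \<and> z k = y \<and>
        (\<forall>i\<in>{1..k-1}. (z i, z (i + 1)) \<in> S)}"

text \<open>In the next definition \<open>W\<close> is the relation modulo which fixed points are unique.\<close>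

definition global_strongly_Picard ::
  "'a set \<Rightarrow> ('a \<Rightarrow> 'a \<Rightarrow> real) \<Rightarrow> 'a rel \<Rightarrow> 'a rel \<Rightarrow> ('a \<Rightarrow> 'a) \<Rightarrow> bool" where
  "global_strongly_Picard X d R W T \<longleftrightarrow>
     (\<forall>x\<in>progress_set X T R. \<exists>l. converges_to X d (\<lambda>n. (T ^^ n) x) l \<and> l \<in> Fix X T) \<and>
     (\<forall>z1\<in>Fix X T. \<forall>z2\<in>Fix X T. (z1, z2) \<in> W \<longrightarrow> z1 = z2)"

end

theory Submission
  imports Defs
begin

text \<open>
  Call two points asymptotic if the distance between their \<open>n\<close>-th iterates tends to \<open>0\<close>.
  Everything rests on one observation: if \<open>x\<close> and \<open>y\<close> are related, then so are all their iterates,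
  so the distances \<open>a\<^sub>n\<close> between the iterates satisfy \<open>a\<^sub>n\<^sub>+\<^sub>1 \<le> \<phi> a\<^sub>n\<close>. Browder
  admissibility makes their sum finite (lemma \<open>related_iterates_summable\<close>).

  Existence of a fixed point uses the finiteness of the sum for the pair \<open>x\<close>, \<open>T x\<close>: the orbit
  of \<open>x\<close> has finite length, so it is a Cauchy sequence
  (lemma \<open>MCauchy_if_summable\<close>), and it is ascending, so it converges to
  some \<open>l\<close>. Along a subsequence the orbit is related to \<open>l\<close>; there \<open>T\<close> does not increase the
  distance to \<open>l\<close>, so the shifted subsequence converges to \<open>T l\<close> as well as to \<open>l\<close>
  (lemma \<open>orbit_converges_to_fixpoint\<close>).

  Uniqueness follows because the terms of the sum tend to \<open>0\<close>: related points are asymptotic,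
  and being asymptotic is symmetric and transitive, so the two ends of a chain are asymptotic.
  Fixed points do not move under iteration, so asymptotic fixed points coincide
  (lemma \<open>chained_fixpoints_equal\<close>).
\<close>

lemma (in Metric_space) MCauchy_if_summable:
  assumes u: "range u \<subseteq> M" and sum: "summable (\<lambda>n. d (u n) (u (Suc n)))"
  shows "MCauchy u"
  unfolding MCauchy_def
proof (intro conjI allI impI u)
  let ?a = "\<lambda>n. d (u n) (u (Suc n))"
  have uM: "u n \<in> M" for n
    using u by blast
  have length_bound: "d (u m) (u (m + k)) \<le> sum ?a {m..<m + k}" for m k
  proof (induction k)
    case (Suc k)
    then show ?case
      using triangle[of "u m" "u (m + k)" "u (Suc (m + k))"] uM by simp
  qed (simp add: uM)
  fix \<epsilon> :: real
  assume "0 < \<epsilon>"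
  then obtain N where N: "\<And>m n. N \<le> m \<Longrightarrow> \<bar>sum ?a {m..<n}\<bar> < \<epsilon>"
    using sum unfolding summable_Cauchy real_norm_def by meson
  have close: "d (u m) (u n) < \<epsilon>" if "N \<le> m" "m \<le> n" for m n
    using length_bound[of m "n - m"] N[OF \<open>N \<le> m\<close>, of n] \<open>m \<le> n\<close> by simp
  have "d (u n) (u n') < \<epsilon>" if "N \<le> n" "N \<le> n'" for n n'
    using close[of n n'] close[of n' n] that commute by (cases "n \<le> n'") auto
  then show "\<exists>N. \<forall>n n'. N \<le> n \<longrightarrow> N \<le> n' \<longrightarrow> d (u n) (u n') < \<epsilon>"
    by blast
qed

text \<open>
  Browder admissibility speaks of positive sequences only. A nonnegative sequence that reaches
  \<open>0\<close> stays there because \<open>\<phi> 0 = 0\<close>, so its series is a finite sum.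
\<close>

lemma Browder_admissible_summable_nonneg:
  assumes "Browder_admissible \<phi>" "\<phi> 0 = 0"
    and nonneg: "\<And>n. 0 \<le> a n" and step: "\<And>n. a (Suc n) \<le> \<phi> (a n)"
  shows "summable a"
proof (cases "\<forall>n. 0 < a n")
  case True
  then show ?thesis
    using assms unfolding Browder_admissible_def by blast
next
  case False
  then obtain N where "a N = 0"
    using nonneg by (meson antisym_conv2 not_less)
  have "a n = 0" if "N \<le> n" for n
    using that
  proof (induction n rule: dec_induct)
    case (step n)
    then show ?case
      using assms(2) nonneg[of "Suc n"] assms(4)[of n] by simp
  qed (fact \<open>a N = 0\<close>)
  then show ?thesis
    by (intro summable_finite[of "{..<N}"]) (auto simp: not_less)
qed

lemma funpow_in_carrier:
  assumes "T \<in> X \<rightarrow> X" "x \<in> X"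
  shows "(T ^^ n) x \<in> X"
  using assms by (induction n) auto

lemma rel_increasing_funpow:
  assumes "T \<in> X \<rightarrow> X" "rel_increasing X R T" "x \<in> X" "y \<in> X" "(x, y) \<in> R"
  shows "((T ^^ n) x, (T ^^ n) y) \<in> R"
proof (induction n)
  case (Suc n)
  then show ?case
    using assms(2) funpow_in_carrier[OF assms(1)] assms(3,4)
    unfolding rel_increasing_def by simp
qed (simp add: assms)

lemma related_iterates_summable:
  assumes "Metric_space X d" "T \<in> X \<rightarrow> X" "rel_increasing X R T"
    and "\<phi> \<in> F0_in_re_Bro" "contractive_wrt X d R \<phi> T"
    and "x \<in> X" "y \<in> X" "(x, y) \<in> R"
  shows "summable (\<lambda>n. d ((T ^^ n) x) ((T ^^ n) y))"
proof (rule Browder_admissible_summable_nonneg)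
  show "Browder_admissible \<phi>" "\<phi> 0 = 0"
    using assms(4) by (auto simp: F0_in_re_Bro_def)
  show "0 \<le> d ((T ^^ n) x) ((T ^^ n) y)" for n
    using assms(1) by (rule Metric_space.nonneg)
  show "d ((T ^^ Suc n) x) ((T ^^ Suc n) y) \<le> \<phi> (d ((T ^^ n) x) ((T ^^ n) y))" for n
    using assms(5) rel_increasing_funpow[OF assms(2,3,6-8)]
      funpow_in_carrier[OF assms(2)] assms(6,7)
    unfolding contractive_wrt_def by simp
qed

text \<open>
  \<open>T\<close> need not be continuous at the limit \<open>l\<close>. The contraction inequality is available only at
  those points of the orbit that are related to \<open>l\<close>, but infinitely many of them are enough to
  identify \<open>T l\<close>.
\<close>

lemma orbit_converges_to_fixpoint:
  assumes metric: "Metric_space X d" and T: "T \<in> X \<rightarrow> X"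
    and \<phi>: "\<phi> \<in> F0_in_re_Bro" "contractive_wrt X d R \<phi> T"
    and complete: "complete_wrt X d R" and selfclosed: "almost_selfclosed X d R"
    and incr: "rel_increasing X R T" and x: "x \<in> progress_set X T R"
  shows "\<exists>l. converges_to X d (\<lambda>n. (T ^^ n) x) l \<and> l \<in> Fix X T"
proof -
  interpret Metric_space X d by (fact metric)
  let ?u = "\<lambda>n. (T ^^ n) x"
  have xX: "x \<in> X" and Tx: "T x \<in> X" and xTx: "(x, T x) \<in> R"
    using x T by (auto simp: progress_set_def)
  have uX: "?u n \<in> X" for n
    using funpow_in_carrier[OF T xX] .
  have orbit_shift: "(T ^^ n) (T x) = ?u (Suc n)" for n
    by (simp add: funpow_swap1)
  have asc: "ascending X R ?u"
    using uX rel_increasing_funpow[OF T incr xX Tx xTx, unfolded orbit_shift]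
    by (auto simp: ascending_def)
  have "summable (\<lambda>n. d (?u n) (?u (Suc n)))"
    using related_iterates_summable[OF metric T incr \<phi> xX Tx xTx, unfolded orbit_shift] .
  then have "MCauchy ?u"
    using uX by (intro MCauchy_if_summable) auto
  then obtain l where l: "l \<in> X" and lim: "limitin mtopology ?u l sequentially"
    using complete asc unfolding complete_wrt_def by blast
  obtain r :: "nat \<Rightarrow> nat" where r: "strict_mono r" and rl: "\<And>n. (?u (r n), l) \<in> R"
    using selfclosed asc l lim unfolding almost_selfclosed_def by blast
  have dist_lim: "(\<lambda>n. d (?u n) l) \<longlonglongrightarrow> 0"
    using lim by (simp add: limitin_metric_dist_null)
  have Tl: "T l \<in> X"
    using T l by blast
  have nonexpansive: "d (?u (Suc (r n))) (T l) \<le> d (?u (r n)) l" for n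
  proof -
    have "d (?u (Suc (r n))) (T l) \<le> \<phi> (d (?u (r n)) l)"
      using \<phi>(2) uX[of "r n"] l rl[of n] unfolding contractive_wrt_def by simp
    also have "\<dots> \<le> d (?u (r n)) l"
    proof (cases "d (?u (r n)) l = 0")
      case False
      then have "0 < d (?u (r n)) l"
        using nonneg[of "?u (r n)" l] by linarith
      then show ?thesis
        using \<phi>(1) unfolding F0_in_re_Bro_def regressive_def by (simp add: less_imp_le)
    qed (use \<phi>(1) in \<open>simp add: F0_in_re_Bro_def\<close>)
    finally show ?thesis .
  qed
  have "d l (T l) \<le> 0"
  proof (rule LIMSEQ_le_const)
    have "(\<lambda>n. d (?u (r n)) l) \<longlonglongrightarrow> 0"
      using LIMSEQ_subseq_LIMSEQ[OF dist_lim r] by (simp add: o_def)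
    moreover have "(\<lambda>n. d (?u (Suc (r n))) l) \<longlonglongrightarrow> 0"
      using LIMSEQ_subseq_LIMSEQ[OF LIMSEQ_Suc[OF dist_lim] r] by (simp add: o_def)
    ultimately show "(\<lambda>n. d (?u (Suc (r n))) l + d (?u (r n)) l) \<longlonglongrightarrow> 0"
      using tendsto_add by fastforce
    have "d l (T l) \<le> d (?u (Suc (r n))) l + d (?u (r n)) l" for n
      using triangle[OF l uX Tl, of "Suc (r n)"] nonexpansive[of n] commute[of l "?u (Suc (r n))"]
      by simp
    then show "\<exists>N. \<forall>n\<ge>N. d l (T l) \<le> d (?u (Suc (r n))) l + d (?u (r n)) l"
      by blast
  qed
  then have "T l = l"
    using nonneg[of l "T l"] zero[OF l Tl] by simp
  then show ?thesis
    using lim l by (auto simp: Fix_def)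
qed

text \<open>
  Only the ends of a chain are fixed points; its inner points move under iteration. Hence the
  induction along the chain carries asymptoticity to the first point, not equality with it.
\<close>

lemma chained_fixpoints_equal:
  assumes metric: "Metric_space X d" and T: "T \<in> X \<rightarrow> X"
    and \<phi>: "\<phi> \<in> F0_in_re_Bro" "contractive_wrt X d R \<phi> T"
    and incr: "rel_increasing X R T"
    and fixed: "p \<in> Fix X T" "q \<in> Fix X T" and chain: "(p, q) \<in> rt_cover X (R \<union> R\<inverse>)"
  shows "p = q"
proof -
  interpret Metric_space X d by (fact metric)
  obtain k z where "2 \<le> k" and zX: "\<And>i. i \<in> {1..k} \<Longrightarrow> z i \<in> X"
    and ends: "z (1::nat) = p" "z k = q"
    and link: "\<And>i. i \<in> {1..k - 1} \<Longrightarrow> (z i, z (i + 1)) \<in> R \<union> R\<inverse>"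
    using chain unfolding rt_cover_def by blast
  have link_asymptotic: "(\<lambda>n. d ((T ^^ n) x) ((T ^^ n) y)) \<longlonglongrightarrow> 0"
    if "x \<in> X" "y \<in> X" "(x, y) \<in> R \<union> R\<inverse>" for x y
    using that summable_LIMSEQ_zero[OF related_iterates_summable[OF metric T incr \<phi>], of x y]
      summable_LIMSEQ_zero[OF related_iterates_summable[OF metric T incr \<phi>], of y x]
      commute by auto
  have "(\<lambda>n. d ((T ^^ n) (z 1)) ((T ^^ n) (z j))) \<longlonglongrightarrow> 0" if "1 \<le> j" "j \<le> k" for j
    using that
  proof (induction j rule: dec_induct)
    case base
    then have "(T ^^ n) (z 1) \<in> X" for n
      using funpow_in_carrier[OF T zX] by simp
    then show ?case
      by simp
  next
    case (step j)
    have inX: "(T ^^ n) (z i) \<in> X" if "i \<in> {1, j, Suc j}" for n i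
      using that step by (intro funpow_in_carrier[OF T zX]) auto
    have "(\<lambda>n. d ((T ^^ n) (z j)) ((T ^^ n) (z (Suc j)))) \<longlonglongrightarrow> 0"
      using link[of j] zX[of j] zX[of "Suc j"] step by (intro link_asymptotic) auto
    then have "(\<lambda>n. d ((T ^^ n) (z 1)) ((T ^^ n) (z j))
        + d ((T ^^ n) (z j)) ((T ^^ n) (z (Suc j)))) \<longlonglongrightarrow> 0"
      using tendsto_add[OF step.IH] step.prems by fastforce
    then show ?case
      by (rule tendsto_sandwich[OF _ _ tendsto_const, rotated 2])
        (auto intro!: always_eventually triangle inX)
  qed
  then have "(\<lambda>n. d ((T ^^ n) p) ((T ^^ n) q)) \<longlonglongrightarrow> 0"
    using \<open>2 \<le> k\<close> ends by fastforce
  moreover have "(T ^^ n) p = p" "(T ^^ n) q = q" for n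
    using fixed by (induction n) (auto simp: Fix_def)
  ultimately have "d p q = 0"
    by (simp add: LIMSEQ_const_iff)
  then show ?thesis
    using fixed zero by (auto simp: Fix_def)
qed

theorem theorem3p1:
  fixes X :: "'a set" and d :: "'a \<Rightarrow> 'a \<Rightarrow> real" and R S :: "'a rel" and T :: "'a \<Rightarrow> 'a"
  assumes "X \<noteq> {}"
    and "Metric_space X d"
    and "R \<subseteq> X \<times> X" and "refl_on X R"
    and "T \<in> X \<rightarrow> X"
    and "S = R \<union> R\<inverse>"
    and "\<exists>\<phi>\<in>F0_in_re_Bro. contractive_wrt X d R \<phi> T"
    and "complete_wrt X d R" and "almost_selfclosed X d R"
    and "rel_increasing X R T" and "semi_progressive X R T"
  shows "global_strongly_Picard X d R (rt_cover X S) T"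
proof -
  obtain \<phi> where \<phi>: "\<phi> \<in> F0_in_re_Bro" "contractive_wrt X d R \<phi> T"
    using assms(7) by blast
  show ?thesis
    unfolding global_strongly_Picard_def
    using orbit_converges_to_fixpoint[OF assms(2,5) \<phi> assms(8-10)]
      chained_fixpoints_equal[OF assms(2,5) \<phi> assms(10)] \<open>S = R \<union> R\<inverse>\<close>
    by simp
qed

end
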